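(* Let $\beta^-,\beta^+>0$, $0<h<1$, and let $K=\triangle A_1A_2A_3$ with $A_1=(0,0)$, $A_2=(h,0)$, $A_3=(0,h)$ be a triangular interface element, let $B$ be an edge of $K$, and let $\mathbf n_B$ be a unit normal to $B$. There exists a constant $C$ independent of the interface location such that for every linear IFE function $v$ on $K$ the following inequalities hold: $$\|\beta v_p\|_{L^2(B)}\le C h^{1/2}|K|^{-1/2}\|\sqrt{\beta}\,\nabla v\|_{L^2(K)},\qquad p=x,y,$$ $$\|\beta\nabla v\cdot\mathbf n_B\|_{L^2(B)}\le C h^{1/2}|K|^{-1/2}\|\sqrt{\beta}\,\nabla v\|_{L^2(K)}.$$
   Context: The interface $\Gamma$ is a curve separating the domain $\Omega\subset\mathbb{R}^2$ into $\Omega^-$ and $\Omega^+$, and $\beta=\beta^-$ on $\Omega^-$, $\beta=\beta^+$ on $\Omega^+$. $K$ is an interface element: $\Gamma$ intersects edges of $K$ at two points $D\ne E$ on different edges, and the straight line $\overline{DE}$ separates $K$ into $K^-$ and $K^+$ ($K^-$, $K^+$ corresponding to the $\Omega^-$ and $\Omega^+$ sides). A linear IFE (immersed finite element) function on $K$ is a function with $v=v^-=c_1^-+c_2^-x+c_3^-y$ on $K^-$ and $v=v^+=c_1^++c_2^+x+c_3^+y$ on $K^+$ satisfying $$v^-(D)=v^+(D),\qquad v^-(E)=v^+(E),\qquad \beta^-\frac{\partial v^-}{\partial \mathbf n_{\overline{DE}}}=\beta^+\frac{\partial v^+}{\partial \mathbf n_{\overline{DE}}},$$ where $\mathbf n_{\overline{DE}}$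 is a unit normal to $\overline{DE}$. Such $v$ is continuous on $K$; $v_x,v_y,\nabla v$ denote its piecewise derivatives, and $\|\cdot\|_{L^2(B)}$ is taken of the piecewise-defined trace from $K$. $|K|$ is the area of $K$. "Independent of the interface location" means independent of how $\Gamma$ cuts $K$ (the positions of $D,E$). The constant may depend on $\beta^\pm$ but not on $h$. *)

theory Defs
  imports "HOL-Analysis.Analysis"
begin

definition A1 :: "real^2" where "A1 = vector [0, 0]"
definition A2 :: "real \<Rightarrow> real^2" where "A2 h = vector [h, 0]"
definition A3 :: "real \<Rightarrow> real^2" where "A3 h = vector [0, h]"

definition tri :: "real \<Rightarrow> (real^2) set" where
  "tri h = convex hull {A1, A2 h, A3 h}"

definition edges :: "real \<Rightarrow> ((real^2) \<times> (real^2)) set" where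
  "edges h = {(A1, A2 h), (A2 h, A3 h), (A3 h, A1)}"

definition separating_curve ::
  "(real^2) set \<Rightarrow> (real^2) set \<Rightarrow> (real^2) set \<Rightarrow> (real^2) set \<Rightarrow> bool" where
  "separating_curve \<Omega> \<Gamma> \<Omega>m \<Omega>p \<longleftrightarrow>
     open \<Omega> \<and> connected \<Omega> \<and> (\<exists>g. path g \<and> \<Gamma> = path_image g) \<and>
     open \<Omega>m \<and> open \<Omega>p \<and> \<Omega>m \<noteq> {} \<and> \<Omega>p \<noteq> {} \<and> \<Omega>m \<inter> \<Omega>p = {} \<and> \<Omega>m \<union> \<Omega>p = \<Omega> - \<Gamma>"

(* Defined by the true interface, not by the line DE.
   The value on the interface itself is a convention. *)
definition coeff :: "real \<Rightarrow> real \<Rightarrow> (real^2) set \<Rightarrow> real^2 \<Rightarrow> real" where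
  "coeff \<beta>m \<beta>p \<Omega>m x = (if x \<in> \<Omega>m then \<beta>m else \<beta>p)"

(* The closed parts of the triangle cut off by the line through D with normal n,
   where n points from the minus side to the plus side. *)
definition K_minus :: "real \<Rightarrow> real^2 \<Rightarrow> real^2 \<Rightarrow> (real^2) set" where
  "K_minus h D n = {x \<in> tri h. n \<bullet> (x - D) \<le> 0}"

definition K_plus :: "real \<Rightarrow> real^2 \<Rightarrow> real^2 \<Rightarrow> (real^2) set" where
  "K_plus h D n = {x \<in> tri h. n \<bullet> (x - D) \<ge> 0}"

(* n is a unit normal of the line DE. The conditions on interiors say that this line really
   separates K. The last two conditions match its sides with the subdomains: off D and E the
   boundary of K does not meet the interface, so each of its two arcs lies in one subdomain.
   Closures are used because edges of K may lie on the boundary of \<Omega>. *)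
definition interface_element ::
  "real \<Rightarrow> (real^2) set \<Rightarrow> (real^2) set \<Rightarrow> (real^2) set \<Rightarrow> (real^2) set
     \<Rightarrow> real^2 \<Rightarrow> real^2 \<Rightarrow> real^2 \<Rightarrow> bool" where
  "interface_element h \<Omega> \<Gamma> \<Omega>m \<Omega>p D E n \<longleftrightarrow>
     separating_curve \<Omega> \<Gamma> \<Omega>m \<Omega>p \<and> tri h \<subseteq> closure \<Omega> \<and>
     \<Gamma> \<inter> frontier (tri h) = {D, E} \<and> D \<noteq> E \<and>
     (\<exists>(P, Q) \<in> edges h. \<exists>(R, S) \<in> edges h.
        (P, Q) \<noteq> (R, S) \<and> D \<in> closed_segment P Q \<and> E \<in> closed_segment R S) \<and>
     norm n = 1 \<and> n \<bullet> (E - D) = 0 \<and>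
     interior (K_minus h D n) \<noteq> {} \<and> interior (K_plus h D n) \<noteq> {} \<and>
     K_minus h D n \<inter> frontier (tri h) \<subseteq> closure \<Omega>m \<and>
     K_plus h D n \<inter> frontier (tri h) \<subseteq> closure \<Omega>p"

definition linear_poly :: "(real^2 \<Rightarrow> real) \<Rightarrow> bool" where
  "linear_poly w \<longleftrightarrow> (\<exists>c1 c2 c3. \<forall>x. w x = c1 + c2 * x $ 1 + c3 * x $ 2)"

definition partial :: "2 \<Rightarrow> (real^2 \<Rightarrow> real) \<Rightarrow> real^2 \<Rightarrow> real" where
  "partial p w x = frechet_derivative w (at x) (axis p 1)"

definition grad :: "(real^2 \<Rightarrow> real) \<Rightarrow> real^2 \<Rightarrow> real^2" where
  "grad w x = (\<chi> p. partial p w x)"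

(* v is a linear IFE function on K with polynomial pieces vm and vp (uniquely determined by v). *)
definition linear_ife ::
  "real \<Rightarrow> real \<Rightarrow> real \<Rightarrow> real^2 \<Rightarrow> real^2 \<Rightarrow> real^2
     \<Rightarrow> (real^2 \<Rightarrow> real) \<Rightarrow> (real^2 \<Rightarrow> real) \<Rightarrow> (real^2 \<Rightarrow> real) \<Rightarrow> bool" where
  "linear_ife \<beta>m \<beta>p h D E n v vm vp \<longleftrightarrow>
     linear_poly vm \<and> linear_poly vp \<and>
     (\<forall>x \<in> K_minus h D n. v x = vm x) \<and> (\<forall>x \<in> K_plus h D n. v x = vp x) \<and>
     vm D = vp D \<and> vm E = vp E \<and>
     (\<forall>x \<in> closed_segment D E. \<beta>m * (grad vm x \<bullet> n) = \<beta>p * (grad vp x \<bullet> n))"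

(* Piecewise functions on K, including their traces on the edges. The line DE meets K and
   each edge in a null set, so the value chosen on it does not affect the norms. *)
definition pw :: "real \<Rightarrow> real^2 \<Rightarrow> real^2 \<Rightarrow> (real^2 \<Rightarrow> 'a) \<Rightarrow> (real^2 \<Rightarrow> 'a) \<Rightarrow> real^2 \<Rightarrow> 'a" where
  "pw h D n fm fp x = (if x \<in> K_minus h D n then fm x else fp x)"

definition L2_edge :: "real^2 \<Rightarrow> real^2 \<Rightarrow> (real^2 \<Rightarrow> real) \<Rightarrow> real" where
  "L2_edge P Q f = sqrt (LINT t:{0..1}|lborel. (f (linepath P Q t))\<^sup>2 * dist P Q)"

definition L2_tri :: "real \<Rightarrow> (real^2 \<Rightarrow> real^2) \<Rightarrow> real" where
  "L2_tri h f = sqrt (LINT x:tri h|lborel. (norm (f x))\<^sup>2)"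

end

theory Submission
  imports Defs
begin

text \<open>
  On each side of the line \<open>DE\<close> an IFE function has a constant gradient. The two
  continuity conditions force the tangential components (along \<open>DE\<close>) of the two
  gradients to agree, and the flux condition makes their normal components proportional with
  ratio \<open>\<beta>m / \<beta>p\<close>. Resolving the gradients in the orthonormal frame of the line shows that
  their lengths differ by a factor of at most \<open>k = max \<beta> / min \<beta>\<close>, wherever and at whatever
  angle the line cuts the element (\<open>norm_le_of_jump_conditions\<close>).

  Hence, even if one of the two pieces of the element or of the edge is tiny, the shorter of the two
  gradients, of length \<open>m\<close>, controls everything. On an edge the integrand is at most
  \<open>max \<beta> * k * m\<close>, and the edge is at most \<open>2 h\<close> long; on the element the integrand is at
  least \<open>sqrt (min \<beta>) * m\<close>, so that the norm there is at least \<open>sqrt (min \<beta>) * m * sqrt \<bar>K\<bar>\<close>.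
  The quotient of the two bounds is the required estimate with
  \<open>C = sqrt 2 * max \<beta> * k / sqrt (min \<beta>)\<close>. The lower bound is pointwise
  and pairs either value of \<open>\<beta>\<close> with either gradient; so it also holds between the curve, where
  \<open>\<beta>\<close> jumps, and the line, where the gradient jumps.
\<close>

lemma linear_poly_grad:
  assumes "linear_poly w"
  obtains g where "\<And>x. grad w x = g" "\<And>p x. partial p w x = g $ p"
    "\<And>x y. w x - w y = g \<bullet> (x - y)"
proof -
  obtain c1 c2 c3 where w: "\<And>x. w x = c1 + c2 * x $ 1 + c3 * x $ 2"
    using assms unfolding linear_poly_def by blast
  define g :: "real^2" where "g = vector [c2, c3]"
  have w': "w = (\<lambda>x. c1 + g \<bullet> x)"
    by (auto simp: w g_def inner_vec_def sum_2 vector_2)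
  have "(w has_derivative (\<lambda>y. g \<bullet> y)) (at x)" for x
    unfolding w' by (auto intro!: derivative_eq_intros)
  then have fd: "frechet_derivative w (at x) = (\<lambda>y. g \<bullet> y)" for x
    using frechet_derivative_at by metis
  have p: "partial p w x = g $ p" for p x
    by (simp add: partial_def fd inner_axis)
  show thesis
  proof (rule that[of g])
    show "grad w x = g" for x
      by (simp add: grad_def p vec_eq_iff)
    show "w x - w y = g \<bullet> (x - y)" for x y
      by (simp add: w' inner_diff_right)
  qed (rule p)
qed

text \<open>
  In the plane, \<open>n\<close> and its rotation by a right angle form an orthonormal basis, and the
  direction \<open>t\<close> of the line is a nonzero multiple of that rotation. Passing from
  \<open>g\<close> to \<open>g'\<close> keeps the coordinate along the line and multiplies the other one by
  \<open>b / b'\<close>.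
\<close>

lemma norm_le_of_jump_conditions:
  fixes g g' n t :: "real^2"
  assumes n: "norm n = 1" "n \<bullet> t = 0" and t: "t \<noteq> 0"
    and tangential: "g \<bullet> t = g' \<bullet> t" and normal: "b * (g \<bullet> n) = b' * (g' \<bullet> n)"
    and b: "0 < b" "0 < b'" "b \<le> k * b'" and k: "1 \<le> k"
  shows "norm g' \<le> k * norm g"
proof -
  define r :: "real^2" where "r = vector [- (n $ 2), n $ 1]"
  have n1: "(n $ 1)\<^sup>2 + (n $ 2)\<^sup>2 = 1"
    using n(1) by (simp add: norm_eq_1 inner_vec_def sum_2 power2_eq_square)
  have nt: "n $ 1 * t $ 1 + n $ 2 * t $ 2 = 0"
    using n(2) by (simp add: inner_vec_def sum_2)
  have pyth: "(norm x)\<^sup>2 = (x \<bullet> n)\<^sup>2 + (x \<bullet> r)\<^sup>2" for x :: "real^2"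
  proof -
    have "(x \<bullet> n)\<^sup>2 + (x \<bullet> r)\<^sup>2 = ((n $ 1)\<^sup>2 + (n $ 2)\<^sup>2) * ((x $ 1)\<^sup>2 + (x $ 2)\<^sup>2)"
      by (simp add: inner_vec_def sum_2 r_def vector_2 power2_eq_square algebra_simps)
    also have "\<dots> = (norm x)\<^sup>2"
      by (simp only: n1 power2_norm_eq_inner) (simp add: inner_vec_def sum_2 power2_eq_square)
    finally show ?thesis by simp
  qed
  have par: "t = (t \<bullet> r) *\<^sub>R r"
  proof -
    have "(t \<bullet> r) * r $ 1 = t $ 1 * ((n $ 1)\<^sup>2 + (n $ 2)\<^sup>2) - n $ 1 * (n $ 1 * t $ 1 + n $ 2 * t $ 2)"
      by (simp add: inner_vec_def sum_2 r_def vector_2 power2_eq_square algebra_simps)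
    moreover have "(t \<bullet> r) * r $ 2 = t $ 2 * ((n $ 1)\<^sup>2 + (n $ 2)\<^sup>2) - n $ 2 * (n $ 1 * t $ 1 + n $ 2 * t $ 2)"
      by (simp add: inner_vec_def sum_2 r_def vector_2 power2_eq_square algebra_simps)
    ultimately show ?thesis
      by (simp add: n1 nt vec_eq_iff forall_2)
  qed
  have tr: "t \<bullet> r \<noteq> 0"
    using par t by auto
  have "(t \<bullet> r) * (g \<bullet> r) = (t \<bullet> r) * (g' \<bullet> r)"
    using tangential par by (metis inner_scaleR_right)
  then have gr: "g' \<bullet> r = g \<bullet> r"
    using tr by simp
  have gn: "g' \<bullet> n = (b / b') * (g \<bullet> n)"
    using normal b by (simp add: field_simps)
  have "(b / b')\<^sup>2 \<le> k\<^sup>2"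
    using b by (intro power_mono) (auto simp: field_simps)
  then have "(g' \<bullet> n)\<^sup>2 \<le> k\<^sup>2 * (g \<bullet> n)\<^sup>2"
    unfolding gn power_mult_distrib by (rule mult_right_mono) simp
  moreover have "(g' \<bullet> r)\<^sup>2 \<le> k\<^sup>2 * (g \<bullet> r)\<^sup>2"
    unfolding gr using mult_right_mono[of 1 "k\<^sup>2" "(g \<bullet> r)\<^sup>2"] k by simp
  ultimately have "(norm g')\<^sup>2 \<le> (k * norm g)\<^sup>2"
    unfolding power_mult_distrib pyth by (simp add: distrib_left)
  then show ?thesis
    by (rule power2_le_imp_le) (use k in auto)
qed

text \<open>
  The pointwise bound is integrated over the unit interval. It gives an upper bound for every
  \<open>f\<close>, since the Bochner integral of a non-integrable function is zero.
\<close>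

lemma L2_edge_le:
  assumes "\<And>x. \<bar>f x\<bar> \<le> c"
  shows "L2_edge P Q f \<le> c * sqrt (dist P Q)"
proof -
  have c: "0 \<le> c"
    using assms[of 0] by linarith
  have sq: "(f x)\<^sup>2 \<le> c\<^sup>2" for x
    using power_mono[OF assms abs_ge_zero, of x 2] by simp
  have "(LINT t:{0..1}|lborel. (f (linepath P Q t))\<^sup>2 * dist P Q)
      \<le> (LINT t:{0..1::real}|lborel. c\<^sup>2 * dist P Q)"
    unfolding set_lebesgue_integral_def
  proof (rule integral_mono')
    show "integrable lborel (\<lambda>t::real. indicator {0..1} t *\<^sub>R (c\<^sup>2 * dist P Q))"
      by simp
  qed (auto simp: indicator_def intro!: mult_right_mono sq)
  also have "\<dots> = c\<^sup>2 * dist P Q"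
    by (simp add: set_lebesgue_integral_def)
  finally have "L2_edge P Q f \<le> sqrt (c\<^sup>2 * dist P Q)"
    unfolding L2_edge_def by simp
  also have "\<dots> = c * sqrt (dist P Q)"
    using c by (simp add: real_sqrt_mult)
  finally show ?thesis .
qed

lemma compact_tri: "compact (tri h)"
  by (simp add: tri_def finite_imp_compact_convex_hull)

text \<open>
  Here the upper bound \<open>u\<close> guarantees integrability; otherwise the Bochner integral could be
  zero by default and the lower bound would fail.
\<close>

lemma le_L2_tri:
  fixes f :: "real^2 \<Rightarrow> real^2"
  assumes f: "f \<in> borel_measurable borel"
    and lower: "\<And>x. a \<le> norm (f x)" "0 \<le> a" and upper: "\<And>x. norm (f x) \<le> u"
  shows "a * sqrt (measure lborel (tri h)) \<le> L2_tri h f"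
proof -
  have S: "tri h \<in> sets lborel"
    using compact_tri by (simp add: compact_imp_closed)
  have fin: "emeasure lborel (tri h) < \<infinity>"
    using compact_tri by (intro emeasure_bounded_finite compact_imp_bounded)
  have const: "set_integrable lborel (tri h) (\<lambda>_. c)" for c :: real
    using S fin by (simp add: set_integrable_def)
  have int: "set_integrable lborel (tri h) (\<lambda>x. (norm (f x))\<^sup>2)"
  proof (rule set_integrable_bound[OF const[of "u\<^sup>2"]])
    show "set_borel_measurable lborel (tri h) (\<lambda>x. (norm (f x))\<^sup>2)"
      unfolding set_borel_measurable_def using S f by measurable
    show "AE x in lborel. x \<in> tri h \<longrightarrow> norm ((norm (f x))\<^sup>2) \<le> norm (u\<^sup>2)"
      using upper by (auto intro!: power_mono)
  qed
  have "a\<^sup>2 * measure lborel (tri h) = (LINT x:tri h|lborel. a\<^sup>2)"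
    using S fin by (simp add: set_lebesgue_integral_def)
  also have "\<dots> \<le> (LINT x:tri h|lborel. (norm (f x))\<^sup>2)"
    by (rule set_integral_mono[OF const int]) (use lower in \<open>auto intro!: power_mono\<close>)
  finally have "sqrt (a\<^sup>2 * measure lborel (tri h)) \<le> L2_tri h f"
    unfolding L2_tri_def by simp
  then show ?thesis
    using lower(2) by (simp add: real_sqrt_mult)
qed

lemma measure_tri_pos:
  assumes "interior (tri h) \<noteq> {}"
  shows "0 < measure lborel (tri h)"
proof -
  obtain x e where e: "0 < e" "ball x e \<subseteq> tri h"
    using assms by (auto simp: mem_interior)
  have "0 < measure lborel (ball x e)"
    using e(1) by (rule content_ball_pos)
  also have "\<dots> \<le> measure lborel (tri h)"
    using e(2) compact_tri
    by (intro measure_mono_fmeasurable)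
      (auto simp: fmeasurable_compact compact_imp_closed)
  finally show ?thesis .
qed

lemma dist_edge_le:
  assumes "0 < h" "(P, Q) \<in> edges h"
  shows "dist P Q \<le> 2 * h"
proof -
  have A: "norm (A1 :: real^2) = 0" "norm (A2 h) = h" "norm (A3 h) = h"
    using assms(1)
    by (simp_all add: A1_def A2_def A3_def norm_vec_def L2_set_def sum_2 vector_2)
  have "dist P Q \<le> norm P + norm Q"
    by (simp add: dist_norm norm_triangle_ineq4)
  also have "\<dots> \<le> 2 * h"
    using assms A by (auto simp: edges_def)
  finally show ?thesis .
qed

lemma closed_K_minus: "closed (K_minus h D n)"
proof -
  have "K_minus h D n = tri h \<inter> {x. n \<bullet> (x - D) \<le> 0}"
    by (auto simp: K_minus_def)
  then show ?thesis
    using compact_imp_closed[OF compact_tri]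
    by (auto intro!: closed_Int closed_Collect_le continuous_intros)
qed

theorem lemma3p2:
  fixes \<beta>m \<beta>p :: real
  assumes "\<beta>m > 0" and "\<beta>p > 0"
  shows "\<exists>C. \<forall>h \<Omega> \<Gamma> \<Omega>m \<Omega>p D E n P Q nB v vm vp.
    0 < h \<and> h < 1 \<and> interface_element h \<Omega> \<Gamma> \<Omega>m \<Omega>p D E n \<and>
    (P, Q) \<in> edges h \<and> norm nB = 1 \<and> nB \<bullet> (Q - P) = 0 \<and>
    linear_ife \<beta>m \<beta>p h D E n v vm vp \<longrightarrow>
      (\<forall>p. L2_edge P Q (pw h D n (\<lambda>x. \<beta>m * partial p vm x) (\<lambda>x. \<beta>p * partial p vp x))
        \<le> C * h powr (1/2) * measure lborel (tri h) powr (-1/2) *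
          L2_tri h (\<lambda>x. sqrt (coeff \<beta>m \<beta>p \<Omega>m x) *\<^sub>R pw h D n (grad vm) (grad vp) x)) \<and>
      L2_edge P Q (pw h D n (\<lambda>x. \<beta>m * (grad vm x \<bullet> nB)) (\<lambda>x. \<beta>p * (grad vp x \<bullet> nB)))
        \<le> C * h powr (1/2) * measure lborel (tri h) powr (-1/2) *
          L2_tri h (\<lambda>x. sqrt (coeff \<beta>m \<beta>p \<Omega>m x) *\<^sub>R pw h D n (grad vm) (grad vp) x)"
proof -
  define b where "b = min \<beta>m \<beta>p"
  define M where "M = max \<beta>m \<beta>p"
  define k where "k = M / b"
  define C where "C = sqrt 2 * M * k / sqrt b"
  have b: "0 < b" "b \<le> \<beta>m" "b \<le> \<beta>p" and M: "0 < M" "\<beta>m \<le> M" "\<beta>p \<le> M"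
    using assms by (auto simp: b_def M_def)
  have k: "1 \<le> k"
    using b M by (simp add: k_def field_simps)
  have kb: "\<beta>m \<le> k * \<beta>p" "\<beta>p \<le> k * \<beta>m"
  proof -
    have "M = k * b"
      using b by (simp add: k_def)
    moreover have "k * b \<le> k * \<beta>p" "k * b \<le> k * \<beta>m"
      using b k by (auto intro!: mult_left_mono)
    ultimately show "\<beta>m \<le> k * \<beta>p" "\<beta>p \<le> k * \<beta>m"
      using M by linarith+
  qed
  show ?thesis
  proof (intro exI[of _ C] allI impI, elim conjE)
    fix h \<Omega> \<Gamma> \<Omega>m \<Omega>p D E and n :: "real^2" and P Q and nB :: "real^2" and v vm vp
    assume h: "0 < h"
      and ie: "interface_element h \<Omega> \<Gamma> \<Omega>m \<Omega>p D E n"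
      and PQ: "(P, Q) \<in> edges h" and nB: "norm nB = 1"
      and ife: "linear_ife \<beta>m \<beta>p h D E n v vm vp"
    let ?F = "\<lambda>x. sqrt (coeff \<beta>m \<beta>p \<Omega>m x) *\<^sub>R pw h D n (grad vm) (grad vp) x"
    let ?K = "measure lborel (tri h)"
    have n: "norm n = 1" "n \<bullet> (E - D) = 0" "E - D \<noteq> 0"
      and "open \<Omega>m" and "interior (K_minus h D n) \<noteq> {}"
      using ie unfolding interface_element_def separating_curve_def by auto
    moreover have "interior (K_minus h D n) \<subseteq> interior (tri h)"
      by (rule interior_mono) (auto simp: K_minus_def)
    ultimately have K: "0 < ?K"
      by (intro measure_tri_pos) auto
    obtain gm where gm: "\<And>x. grad vm x = gm" "\<And>p x. partial p vm x = gm $ p"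
        "\<And>x y. vm x - vm y = gm \<bullet> (x - y)"
      using ife linear_poly_grad unfolding linear_ife_def by metis
    obtain gp where gp: "\<And>x. grad vp x = gp" "\<And>p x. partial p vp x = gp $ p"
        "\<And>x y. vp x - vp y = gp \<bullet> (x - y)"
      using ife linear_poly_grad unfolding linear_ife_def by metis
    have tangential: "gm \<bullet> (E - D) = gp \<bullet> (E - D)"
      using ife unfolding linear_ife_def by (simp flip: gm(3) gp(3))
    have normal: "\<beta>m * (gm \<bullet> n) = \<beta>p * (gp \<bullet> n)"
      using ife unfolding linear_ife_def by (auto simp: gm gp)
    have "norm gp \<le> k * norm gm"
      by (rule norm_le_of_jump_conditions[OF n tangential normal assms kb(1) k])
    moreover have "norm gm \<le> k * norm gp"
      by (rule norm_le_of_jump_conditions[OF n tangential[symmetric] normal[symmetric]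
            assms(2,1) kb(2) k])
    moreover define m where "m = min (norm gm) (norm gp)"
    moreover have "norm gm \<le> k * norm gm" "norm gp \<le> k * norm gp"
      using k by (simp_all add: mult_le_cancel_right1)
    ultimately have upper: "norm gm \<le> k * m" "norm gp \<le> k * m"
      by (auto simp: min_def)
    have m: "0 \<le> m" "m \<le> norm gm" "m \<le> norm gp"
      by (auto simp: m_def)

    have tri_bound: "sqrt b * m * sqrt ?K \<le> L2_tri h ?F"
    proof (rule le_L2_tri)
      have "coeff \<beta>m \<beta>p \<Omega>m \<in> borel_measurable borel"
        unfolding coeff_def using borel_open[OF \<open>open \<Omega>m\<close>] by measurable
      moreover have "pw h D n (grad vm) (grad vp) \<in> borel_measurable borel"
        unfolding pw_def gm gp using borel_closed[OF closed_K_minus, of h D n] by measurable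
      ultimately show "?F \<in> borel_measurable borel"
        by measurable
      show "sqrt b * m \<le> norm (?F x)" for x
        using b m assms by (auto simp: coeff_def pw_def gm gp intro!: mult_mono)
      show "norm (?F x) \<le> sqrt M * (k * m)" for x
        using M upper assms by (auto simp: coeff_def pw_def gm gp intro!: mult_mono)
      show "0 \<le> sqrt b * m"
        using b m by simp
    qed

    have edge_bound: "L2_edge P Q f \<le> C * h powr (1/2) * ?K powr (-1/2) * L2_tri h ?F"
      if f: "\<And>x. \<bar>f x\<bar> \<le> M * (k * m)" for f
    proof -
      have "L2_edge P Q f \<le> M * (k * m) * sqrt (dist P Q)"
        by (rule L2_edge_le[OF f])
      also have "\<dots> \<le> M * (k * m) * sqrt (2 * h)"
        using dist_edge_le[OF h PQ] M k m by (intro mult_left_mono) auto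
      also have "\<dots> = C * sqrt h * (1 / sqrt ?K) * (sqrt b * m * sqrt ?K)"
        using b K by (simp add: C_def real_sqrt_mult field_simps)
      also have "\<dots> \<le> C * sqrt h * (1 / sqrt ?K) * L2_tri h ?F"
        using b h K M k by (intro mult_left_mono[OF tri_bound]) (auto simp: C_def)
      also have "\<dots> = C * h powr (1/2) * ?K powr (-1/2) * L2_tri h ?F"
      proof -
        have "?K powr (-1/2) = 1 / sqrt ?K"
          using K powr_minus_divide[of ?K "1/2"] by (simp add: powr_half_sqrt)
        then show ?thesis
          using h by (simp add: powr_half_sqrt)
      qed
      finally show ?thesis .
    qed

    have flux: "\<bar>\<beta>m * c\<bar> \<le> M * (k * m)" if "\<bar>c\<bar> \<le> norm gm" for c
      using that upper M assms by (auto simp: abs_mult intro!: mult_mono)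
    have flux': "\<bar>\<beta>p * c\<bar> \<le> M * (k * m)" if "\<bar>c\<bar> \<le> norm gp" for c
      using that upper M assms by (auto simp: abs_mult intro!: mult_mono)
    have dir: "\<bar>g \<bullet> nB\<bar> \<le> norm g" for g
      using Cauchy_Schwarz_ineq2[of g nB] nB by simp
    show "(\<forall>p. L2_edge P Q (pw h D n (\<lambda>x. \<beta>m * partial p vm x) (\<lambda>x. \<beta>p * partial p vp x))
        \<le> C * h powr (1/2) * ?K powr (-1/2) * L2_tri h ?F) \<and>
      L2_edge P Q (pw h D n (\<lambda>x. \<beta>m * (grad vm x \<bullet> nB)) (\<lambda>x. \<beta>p * (grad vp x \<bullet> nB)))
        \<le> C * h powr (1/2) * ?K powr (-1/2) * L2_tri h ?F"
      by (intro conjI allI edge_bound)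
        (auto simp: pw_def gm gp intro!: flux flux' component_le_norm_cart dir)
  qed
qed

end
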